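(* Let $A,B,C$ be three logically independent events and let $\mathcal I=[x_1,x_2]\times[y_1,y_2]\times[t_1,t_2]\subseteq[0,1]^3$ be an imprecise assessment on $(B|C,\ \overline{B}|A,\ A|(A\vee C))$. Then the set $\Sigma$ of the coherent extensions of $\mathcal I$ to $\overline{C}|A$ is the interval $[z^*,z^{**}]$, where \[ [z^*,z^{**}]=\begin{cases} [0,1], & \text{if } (x_2+y_2t_1\ge t_1)\wedge(x_1+y_1t_1\le 1),\\[2pt] \left[\dfrac{x_1+y_1t_1-1}{t_1x_1},\,1\right], & \text{if } x_1+y_1t_1>1,\\[8pt] \left[\dfrac{t_1-x_2-y_2t_1}{t_1(1-x_2)},\,1\right], & \text{if } x_2+y_2t_1<t_1. \end{cases} \]
   Context: Events are elements of a Boolean algebra (e.g. subsets of a set $\Omega$), identified with their $\{0,1\}$-valued indicators; $\overline{E}$ is the negation of $E$ and juxtaposition or $\wedge$ (between events) is conjunction. Events $A,B,C$ are logically independent if all $8$ conjunctions obtained by choosing each of them or its negation are different from the impossible event $\bot$. For events $E,H$ with $H\ne\bot$, the conditional event $E|H$ is true if $EH$ is true, false if $\overline{E}H$ is true, and void if $H$ is false. Coherence: an assessment $\mathcal P=(p_1,\dots,p_n)\in\mathbb R^n$ on $\mathcal F=(E_1|H_1,\dots,E_n|H_n)$ is coherent if for every nonempty $J\subseteq\{1,\dots,n\}$ and all real numbers $s_j$ ($j\in J$), the random gain $G=\sum_{j\in J}s_jH_j(E_j-p_j)$, restricted to $\bigvee_{j\in J}H_j$ (i.e. considering only its values when at least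 one $H_j$, $j\in J$, is true), has minimum $\le 0$ and maximum $\ge 0$. An imprecise assessment on $\mathcal F$ is a set $\mathcal I\subseteq[0,1]^n$ of precise assessments on $\mathcal F$. The set $\Sigma$ of coherent extensions of $\mathcal I$ to a further conditional event $E_{n+1}|H_{n+1}$ is the set of all $z\in[0,1]$ such that, for some coherent $\mathcal P\in\mathcal I$, the assessment $(\mathcal P,z)$ on $(\mathcal F,E_{n+1}|H_{n+1})$ is coherent. The intervals $[x_1,x_2]$, $[y_1,y_2]$, $[t_1,t_2]$ are nonempty. *)

theory Defs
  imports Complex_Main
begin

text \<open>Events are elements of an arbitrary Boolean algebra. The conditional event
  $E|H$ is the pair \<open>(E, H)\<close>; only pairs with \<open>H \<noteq> bot\<close> are conditional events.\<close>

type_synonym 'a cond_event = "'a \<times> 'a"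

definition literal :: "'a::boolean_algebra \<Rightarrow> bool \<Rightarrow> 'a" where
  "literal X b = (if b then X else - X)"

definition logically_independent :: "'a::boolean_algebra \<Rightarrow> 'a \<Rightarrow> 'a \<Rightarrow> bool" where
  "logically_independent A B C \<longleftrightarrow>
     (\<forall>a b c. inf (inf (literal A a) (literal B b)) (literal C c) \<noteq> bot)"

text \<open>In a general Boolean algebra there are no sample points at which indicators could be
  evaluated. Their role is played by assignments \<open>v\<close> of truth values whose associated
  conjunction of the (finitely many) events in question is not the impossible event; if the
  events are subsets of a set, these are the assignments realised at some point of that set.
  Only the values of \<open>v\<close> on \<open>set Xs\<close> matter.\<close>

definition possible :: "'a::boolean_algebra list \<Rightarrow> ('a \<Rightarrow> bool) \<Rightarrow> bool" where
  "possible Xs v \<longleftrightarrow> foldr inf (map (\<lambda>X. literal X (v X)) Xs) top \<noteq> bot"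

definition gain ::
  "'a cond_event list \<Rightarrow> real list \<Rightarrow> nat set \<Rightarrow> (nat \<Rightarrow> real) \<Rightarrow> ('a \<Rightarrow> bool) \<Rightarrow> real" where
  "gain F P J s v =
     (\<Sum>j\<in>J. s j * of_bool (v (snd (F ! j))) * (of_bool (v (fst (F ! j))) - P ! j))"

text \<open>Values of the random gain restricted to the disjunction of the conditioning events
  with index in \<open>J\<close>.\<close>

definition gain_values ::
  "'a::boolean_algebra cond_event list \<Rightarrow> real list \<Rightarrow> nat set \<Rightarrow> (nat \<Rightarrow> real) \<Rightarrow> real set" where
  "gain_values F P J s =
     gain F P J s ` {v. possible (map fst F @ map snd F) v \<and> (\<exists>j\<in>J. v (snd (F ! j)))}"

lemma finite_gain_values:
  assumes "finite J"
  shows "finite (gain_values F P J s)"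
proof -
  let ?g = "\<lambda>(S, T). \<Sum>j\<in>J. s j * of_bool (j \<in> S) * (of_bool (j \<in> T) - P ! j)"
  have "gain F P J s v \<in> ?g ` (Pow J \<times> Pow J)" for v
  proof (rule image_eqI)
    show "gain F P J s v = ?g ({j\<in>J. v (snd (F ! j))}, {j\<in>J. v (fst (F ! j))})"
      by (auto simp: gain_def intro!: sum.cong)
  qed auto
  then have "gain_values F P J s \<subseteq> ?g ` (Pow J \<times> Pow J)"
    unfolding gain_values_def by blast
  then show ?thesis
    using assms by (meson finite_Pow_iff finite_SigmaI finite_imageI finite_subset)
qed

text \<open>By the lemma above, and since the conditioning events are not impossible, \<open>Min\<close> and
  \<open>Max\<close> are applied here to finite nonempty sets.\<close>

definition coherent :: "'a::boolean_algebra cond_event list \<Rightarrow> real list \<Rightarrow> bool" where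
  "coherent F P \<longleftrightarrow>
     length P = length F \<and> (\<forall>(E, H)\<in>set F. H \<noteq> bot) \<and>
     (\<forall>J s. J \<noteq> {} \<and> J \<subseteq> {..<length F} \<longrightarrow>
        Min (gain_values F P J s) \<le> 0 \<and> 0 \<le> Max (gain_values F P J s))"

definition coherent_extensions ::
  "'a::boolean_algebra cond_event list \<Rightarrow> real list set \<Rightarrow> 'a cond_event \<Rightarrow> real set" where
  "coherent_extensions F I K =
     {z \<in> {0..1}. \<exists>P\<in>I. coherent F P \<and> coherent (F @ [K]) (P @ [z])}"

end

theory Submission imports Defs begin

text \<open>
  Suppose a conditional probability takes the values $x$, $y$, $t$, $z$ on $B|C$,
  $\overline{B}|A$, $A|(A\vee C)$, $\overline{C}|A$. Measured relative to $A\vee C$, the event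
  $A\overline{C}$ has probability $zt$, so $C$ has probability $1-zt$; hence $BC$ has probability
  $x(1-zt)$ and $A\overline{B}$ has probability $yt$. These two events are incompatible, so
  $x(1-zt)+yt\le 1$. Exchanging $B$ and $\overline{B}$ replaces $x,y$ by $1-x,1-y$ and gives
  $(1-x)(1-zt)+(1-y)t\le 1$. Both inequalities are instances of \<open>jointly_bounded\<close>.

  For numbers in the unit interval these two inequalities characterise coherence. They are
  necessary because a violation yields stakes with a sure loss
  (\<open>jointly_bounded_if_coherent\<close>). They are sufficient because they are exactly what is needed
  to choose the mass of $A\overline{B}C$ so that all eight atoms get nonnegative masses
  (\<open>joint_mass_exists\<close>); a distribution under which every bet is fair excludes sure wins and
  sure losses (\<open>no_sure_win_if_balanced\<close>). That distribution may give mass zero to the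
  conditioning events of a subfamily, and such subfamilies get a distribution of their own
  (\<open>coherent_if_jointly_bounded\<close>).

  The interval then follows by elementary analysis of the two inequalities on the box. The first
  one becomes weaker when $x$, $y$, $t$ decrease, the second one when $1-x$, $1-y$, $t$ decrease
  (\<open>jointly_bounded_antimono\<close>), so only $t_1$ and the corners $(x_1,y_1)$ and $(x_2,y_2)$
  matter. If $x+yt\le 1$ the first inequality holds for every $z$, and if $x+yt\ge t$ the second
  one does. In the first case of the theorem a point of the box satisfies both conditions; in the
  other two cases one inequality holds throughout the box, and the other one, solved for $z$ at
  its most favourable corner, is the lower bound.
\<close>

section \<open>Possible truth assignments\<close>

lemma literal_foldr_le:
  fixes Xs :: "'a::boolean_algebra list"
  assumes "X \<in> set Xs"
  shows "foldr inf (map (\<lambda>X. literal X (v X)) Xs) top \<le> literal X (v X)"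
  using assms by (induction Xs) (auto intro: le_infI1 le_infI2)

lemma le_literal_foldr:
  fixes m :: "'a::boolean_algebra"
  assumes "\<And>X. X \<in> set Xs \<Longrightarrow> m \<le> literal X (v X)"
  shows "m \<le> foldr inf (map (\<lambda>X. literal X (v X)) Xs) top"
  using assms by (induction Xs) auto

text \<open>A witness below all literals is easier to handle than their conjunction: it can be compared
  with each event separately, and shrinking it keeps it a witness.\<close>

lemma possible_iff:
  "possible Xs v \<longleftrightarrow> (\<exists>m. m \<noteq> bot \<and> (\<forall>X\<in>set Xs. m \<le> literal X (v X)))"
proof
  assume "possible Xs v"
  then show "\<exists>m. m \<noteq> bot \<and> (\<forall>X\<in>set Xs. m \<le> literal X (v X))"
    unfolding possible_def using literal_foldr_le by blast
next
  assume "\<exists>m. m \<noteq> bot \<and> (\<forall>X\<in>set Xs. m \<le> literal X (v X))"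
  then obtain m where m: "m \<noteq> bot" "\<And>X. X \<in> set Xs \<Longrightarrow> m \<le> literal X (v X)" by blast
  then show "possible Xs v"
    unfolding possible_def using le_literal_foldr[of Xs m v] by (metis bot.extremum_uniqueI)
qed

lemma possible_subset:
  assumes "possible Ys v" "set Xs \<subseteq> set Ys"
  shows "possible Xs v"
  using assms unfolding possible_iff by blast

text \<open>A nonzero element can be cut successively by each event of a list or by its complement,
  always keeping a nonzero part. An event that occurs again later in the list forces the same
  choice, so the choices do form a valuation.\<close>

lemma refine_by_literals:
  fixes m :: "'a::boolean_algebra"
  assumes "m \<noteq> bot"
  shows "\<exists>m' v. m' \<noteq> bot \<and> m' \<le> m \<and> (\<forall>X\<in>set Xs. m' \<le> literal X (v X))"
  using assms
proof (induction Xs arbitrary: m)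
  case (Cons X Xs)
  have "sup (inf m X) (inf m (- X)) = m"
    by (simp flip: inf_sup_distrib1)
  then obtain b where b: "inf m (literal X b) \<noteq> bot"
    using Cons.prems unfolding literal_def by (metis sup_bot.right_neutral)
  obtain m' v where m': "m' \<noteq> bot" "m' \<le> inf m (literal X b)"
    and v: "\<And>Y. Y \<in> set Xs \<Longrightarrow> m' \<le> literal Y (v Y)"
    using Cons.IH[OF b] by blast
  have "m' \<le> literal Y ((v(X := b)) Y)" if "Y \<in> set (X # Xs)" for Y
    using that m'(2) v by (cases "Y = X") auto
  then show ?case
    using m' by (meson le_infE)
qed auto

lemma ex_possible:
  fixes H :: "'a::boolean_algebra"
  assumes "H \<noteq> bot" "H \<in> set Xs"
  shows "\<exists>v. possible Xs v \<and> v H"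
proof -
  obtain m v where m: "m \<noteq> bot" "m \<le> H" "\<forall>X\<in>set Xs. m \<le> literal X (v X)"
    using refine_by_literals[OF assms(1), of Xs] by blast
  have "v H"
  proof (rule ccontr)
    assume "\<not> v H"
    then have "m \<le> - H"
      using m(3) assms(2) by (auto simp: literal_def split: if_splits)
    with m(2) have "m \<le> inf H (- H)"
      by (rule le_infI)
    then show False
      using m(1) by (simp add: bot.extremum_unique)
  qed
  then show ?thesis
    using m unfolding possible_iff by blast
qed

text \<open>Valuations are arbitrary functions on the algebra; possible ones nevertheless respect the
  Boolean operations among the listed events.\<close>

lemma possible_compl:
  fixes X :: "'a::boolean_algebra"
  assumes "possible Xs v" "X \<in> set Xs" "- X \<in> set Xs"
  shows "v (- X) \<longleftrightarrow> \<not> v X"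
proof -
  obtain m where m: "m \<noteq> bot" "m \<le> literal X (v X)" "m \<le> literal (- X) (v (- X))"
    using assms unfolding possible_iff by blast
  have "\<not> (m \<le> X \<and> m \<le> - X)"
    using m(1) by (metis inf_compl_bot le_inf_iff bot.extremum_uniqueI)
  then show ?thesis
    using m by (auto simp: literal_def split: if_splits)
qed

lemma possible_sup:
  fixes X :: "'a::boolean_algebra"
  assumes "possible Xs v" "X \<in> set Xs" "Y \<in> set Xs" "sup X Y \<in> set Xs"
  shows "v (sup X Y) \<longleftrightarrow> v X \<or> v Y"
proof -
  obtain m where m: "m \<noteq> bot" "m \<le> literal X (v X)" "m \<le> literal Y (v Y)"
      "m \<le> literal (sup X Y) (v (sup X Y))"
    using assms unfolding possible_iff by blast
  have *: "\<not> (m \<le> Z \<and> m \<le> - Z)" for Z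
    using m(1) by (metis inf_compl_bot le_inf_iff bot.extremum_uniqueI)
  show ?thesis
    using m *[of X] *[of Y] *[of "sup X Y"]
    by (auto simp: literal_def le_supI1 le_supI2 split: if_splits)
qed

section \<open>Coherence\<close>

text \<open>It suffices to exclude sure wins, because all real stakes are allowed.\<close>

lemma coherentI:
  assumes "length P = length F" "\<And>E H. (E, H) \<in> set F \<Longrightarrow> H \<noteq> bot"
    and loss: "\<And>J s. J \<noteq> {} \<Longrightarrow> J \<subseteq> {..<length F} \<Longrightarrow>
      \<exists>v. possible (map fst F @ map snd F) v \<and> (\<exists>j\<in>J. v (snd (F ! j))) \<and> gain F P J s v \<le> 0"
  shows "coherent F P"
proof -
  have "Min (gain_values F P J s) \<le> 0 \<and> 0 \<le> Max (gain_values F P J s)"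
    if J: "J \<noteq> {}" "J \<subseteq> {..<length F}" for J s
  proof
    have fin: "finite (gain_values F P J s)"
      using J by (intro finite_gain_values) (auto intro: finite_subset)
    obtain v where "gain F P J s v \<in> gain_values F P J s" "gain F P J s v \<le> 0"
      using loss[OF J, of s] unfolding gain_values_def by blast
    then show "Min (gain_values F P J s) \<le> 0"
      using fin by (meson Min_le order_trans)
    \<comment> \<open>Reversing all stakes turns a loss into a win.\<close>
    have "gain F P J (\<lambda>j. - s j) v = - gain F P J s v" for v
      by (simp add: gain_def sum_negf)
    then obtain v where "gain F P J s v \<in> gain_values F P J s" "0 \<le> gain F P J s v"
      using loss[OF J, of "\<lambda>j. - s j"] unfolding gain_values_def by auto
    then show "0 \<le> Max (gain_values F P J s)"
      using fin by (meson Max_ge order_trans)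
  qed
  then show ?thesis
    using assms(1,2) unfolding coherent_def by blast
qed

text \<open>The maximum is attained at some valuation: the set of gain values is nonempty because a
  conditioning event is not impossible.\<close>

lemma coherentE:
  assumes "coherent F P" "J \<noteq> {}" "J \<subseteq> {..<length F}"
  obtains v where "possible (map fst F @ map snd F) v" "\<exists>j\<in>J. v (snd (F ! j))"
    "0 \<le> gain F P J s v"
proof -
  obtain j where j: "j \<in> J" "j < length F"
    using assms by blast
  then have "F ! j \<in> set F" by simp
  moreover from this have "snd (F ! j) \<noteq> bot"
    using assms(1) unfolding coherent_def by (auto simp: split_beta)
  ultimately obtain v where "possible (map fst F @ map snd F) v" "v (snd (F ! j))"
    using ex_possible[of "snd (F ! j)" "map fst F @ map snd F"] by auto
  then have "gain_values F P J s \<noteq> {}"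
    using j unfolding gain_values_def by blast
  moreover have "finite (gain_values F P J s)"
    using assms by (intro finite_gain_values) (auto intro: finite_subset)
  ultimately have "Max (gain_values F P J s) \<in> gain_values F P J s"
    by simp
  moreover have "0 \<le> Max (gain_values F P J s)"
    using assms unfolding coherent_def by blast
  ultimately obtain g where "g \<in> gain_values F P J s" "0 \<le> g"
    by blast
  then show thesis
    using that unfolding gain_values_def by blast
qed

lemma coherent_butlast:
  assumes "coherent (F @ [K]) (P @ [z])"
  shows "coherent F P"
proof (rule coherentI)
  show len: "length P = length F" and "\<And>E H. (E, H) \<in> set F \<Longrightarrow> H \<noteq> bot"
    using assms unfolding coherent_def by auto
  fix J and s :: "nat \<Rightarrow> real"
  assume J: "J \<noteq> {}" "J \<subseteq> {..<length F}"
  then have J': "J \<subseteq> {..<length (F @ [K])}" by auto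
  obtain v where v: "possible (map fst (F @ [K]) @ map snd (F @ [K])) v"
      "\<exists>j\<in>J. v (snd ((F @ [K]) ! j))" "0 \<le> gain (F @ [K]) (P @ [z]) J (\<lambda>j. - s j) v"
    using coherentE[OF assms J(1) J'] by blast
  have nth: "(F @ [K]) ! j = F ! j" "(P @ [z]) ! j = P ! j" if "j \<in> J" for j
    using that J(2) len by (auto simp: nth_append)
  have "possible (map fst F @ map snd F) v"
    using v(1) by (rule possible_subset) auto
  moreover have "gain (F @ [K]) (P @ [z]) J (\<lambda>j. - s j) v = - gain F P J s v"
    by (simp add: gain_def nth sum_negf)
  ultimately show
    "\<exists>v. possible (map fst F @ map snd F) v \<and> (\<exists>j\<in>J. v (snd (F ! j))) \<and> gain F P J s v \<le> 0"
    using v nth by auto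
qed

text \<open>If the masses \<open>w\<close> make every single bet fair, the mean gain is zero for all stakes. A gain
  that is positive wherever some bet is on would have a positive mean, as long as some mass lies
  there. Each \<open>J\<close> may come with masses of its own.\<close>

lemma no_sure_win_if_balanced:
  fixes w :: "'i \<Rightarrow> real"
  assumes "finite I" "\<And>i. i \<in> I \<Longrightarrow> 0 \<le> w i"
    and pos: "i0 \<in> I" "0 < w i0" "\<exists>j\<in>J. V i0 (snd (F ! j))"
    and bal: "\<And>j. j \<in> J \<Longrightarrow>
      (\<Sum>i\<in>I. w i * (of_bool (V i (snd (F ! j))) * (of_bool (V i (fst (F ! j))) - P ! j))) = 0"
  shows "\<exists>i\<in>I. (\<exists>j\<in>J. V i (snd (F ! j))) \<and> gain F P J s (V i) \<le> 0"
proof (rule ccontr)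
  assume no: "\<not> ?thesis"
  have void: "gain F P J s (V i) = 0" if "\<not> (\<exists>j\<in>J. V i (snd (F ! j)))" for i
    using that by (auto simp: gain_def intro: sum.neutral)
  have "0 \<le> w i * gain F P J s (V i)" if "i \<in> I" for i
    using assms(2)[OF that] no void[of i] that by (cases "\<exists>j\<in>J. V i (snd (F ! j))") force+
  moreover have "0 < w i0 * gain F P J s (V i0)"
    using no pos by (auto simp: not_le)
  ultimately have "0 < (\<Sum>i\<in>I. w i * gain F P J s (V i))"
    using assms(1) pos(1) by (intro sum_pos2) auto
  also have "\<dots> = (\<Sum>i\<in>I. \<Sum>j\<in>J. s j *
      (w i * (of_bool (V i (snd (F ! j))) * (of_bool (V i (fst (F ! j))) - P ! j))))"
    by (simp add: gain_def sum_distrib_left mult_ac)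
  also have "\<dots> = (\<Sum>j\<in>J. s j * (\<Sum>i\<in>I.
      w i * (of_bool (V i (snd (F ! j))) * (of_bool (V i (fst (F ! j))) - P ! j))))"
    by (subst sum.swap) (simp add: sum_distrib_left)
  also have "\<dots> = 0"
    by (simp add: bal)
  finally show False by simp
qed

section \<open>The coherent precise assessments\<close>

text \<open>The left-hand side is the total probability, given $A\vee C$, of the incompatible events $BC$
  and $A\overline{B}$.\<close>

definition jointly_bounded :: "real \<Rightarrow> real \<Rightarrow> real \<Rightarrow> real \<Rightarrow> bool" where
  "jointly_bounded x y t z \<longleftrightarrow> x * (1 - z * t) + y * t \<le> 1"

abbreviation family :: "'a::boolean_algebra \<Rightarrow> 'a \<Rightarrow> 'a \<Rightarrow> 'a cond_event list" where
  "family A B C \<equiv> [(B, C), (- B, A), (A, sup A C), (- C, A)]"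

lemma family_index_set:
  "{..<length (family A B C)} = {0, 1, 2, 3}"
  by auto

text \<open>The incompatibility of $BC$ and $A\overline{B}$ is turned into a bet: on $A\vee C$, the stakes
  $1$, $1$, $y-xz$, $-x$ have the gain $BC+A\overline{B}-(x(1-zt)+yt)$, and the sum of the two
  indicators never exceeds one. The second bound comes from $\overline{B}$ in place of $B$.\<close>

lemma jointly_bounded_if_coherent:
  fixes A B C :: "'a::boolean_algebra"
  assumes "coherent (family A B C) [x, y, t, z]"
  shows "jointly_bounded x y t z" "jointly_bounded (1 - x) (1 - y) t z"
proof -
  let ?F = "family A B C"
  have no_win: "\<exists>a b c. (a \<or> c) \<and> 0 \<le> s0 * of_bool c * (of_bool b - x)
      + s1 * of_bool a * (of_bool (\<not> b) - y) + s2 * (of_bool a - t)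
      + s3 * of_bool a * (of_bool (\<not> c) - z)" for s0 s1 s2 s3 :: real
  proof -
    have ne: "{0, 1, 2, 3 :: nat} \<noteq> {}" by simp
    obtain v where v: "possible (map fst ?F @ map snd ?F) v"
        "\<exists>j\<in>{0, 1, 2, 3}. v (snd (?F ! j))"
        "0 \<le> gain ?F [x, y, t, z] {0, 1, 2, 3} ((!) [s0, s1, s2, s3]) v"
      using coherentE[OF assms ne, of "(!) [s0, s1, s2, s3]"]
      unfolding family_index_set by blast
    have "v (- B) \<longleftrightarrow> \<not> v B" "v (- C) \<longleftrightarrow> \<not> v C" "v (sup A C) \<longleftrightarrow> v A \<or> v C"
      by (intro possible_compl[OF v(1)] possible_sup[OF v(1)]; simp)+
    then show ?thesis
      using v(2,3)
      by (intro exI[of _ "v A"] exI[of _ "v B"] exI[of _ "v C"])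
         (auto simp: gain_def add.assoc)
  qed
  show "jointly_bounded x y t z"
    using no_win[of 1 1 "y - x * z" "- x"]
    by (auto simp: jointly_bounded_def of_bool_def algebra_simps split: if_splits)
  show "jointly_bounded (1 - x) (1 - y) t z"
    using no_win[of "- 1" "- 1" "(1 - y) - (1 - x) * z" "- (1 - x)"]
    by (auto simp: jointly_bounded_def of_bool_def algebra_simps split: if_splits)
qed

text \<open>Reading off truth values at the atom with signs \<open>(a, b, c)\<close> makes the valuation consistent on
  all events generated by the three given ones at once.\<close>

definition atom_valuation ::
  "'a::boolean_algebra \<Rightarrow> 'a \<Rightarrow> 'a \<Rightarrow> bool \<times> bool \<times> bool \<Rightarrow> 'a \<Rightarrow> bool" where
  "atom_valuation A B C = (\<lambda>(a, b, c) X.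
     inf (inf (literal A a) (literal B b)) (literal C c) \<le> X)"

lemma atom_valuation:
  fixes A B C :: "'a::boolean_algebra"
  assumes "logically_independent A B C"
  defines "V \<equiv> atom_valuation A B C"
  shows "V (a, b, c) A = a" "V (a, b, c) B = b" "V (a, b, c) C = c"
    "V (a, b, c) (- B) = (\<not> b)" "V (a, b, c) (- C) = (\<not> c)"
    "V (a, b, c) (sup A C) = (a \<or> c)"
    "possible (map fst (family A B C) @ map snd (family A B C)) (V (a, b, c))"
proof -
  define m where "m = inf (inf (literal A a) (literal B b)) (literal C c)"
  have V: "V (a, b, c) X \<longleftrightarrow> m \<le> X" for X
    by (simp add: V_def atom_valuation_def m_def)
  have m: "m \<noteq> bot"
    using assms by (simp add: logically_independent_def m_def)
  have le: "m \<le> literal A a" "m \<le> literal B b" "m \<le> literal C c"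
    by (auto simp: m_def intro: le_infI1)
  have contra: "\<not> (m \<le> Z \<and> m \<le> - Z)" for Z
    using m by (metis inf_compl_bot le_inf_iff bot.extremum_uniqueI)
  show A: "V (a, b, c) A = a" and B: "V (a, b, c) B = b" and C: "V (a, b, c) C = c"
    and nB: "V (a, b, c) (- B) = (\<not> b)" and nC: "V (a, b, c) (- C) = (\<not> c)"
    using le contra[of A] contra[of B] contra[of C]
    by (auto simp: V literal_def split: if_splits)
  have nsup: "m \<le> - sup A C" if "\<not> a" "\<not> c"
    using that le by (simp add: literal_def)
  then show S: "V (a, b, c) (sup A C) = (a \<or> c)"
    using le contra[of "sup A C"] by (auto simp: V literal_def le_supI1 le_supI2 split: if_splits)
  show "possible (map fst (family A B C) @ map snd (family A B C)) (V (a, b, c))"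
    unfolding possible_iff
  proof (intro exI conjI ballI)
    fix X assume "X \<in> set (map fst (family A B C) @ map snd (family A B C))"
    then consider "X = A" | "X = B" | "X = C" | "X = - B" | "X = - C" | "X = sup A C"
      by auto
    then show "m \<le> literal X (V (a, b, c) X)"
    proof cases
      case 6
      show ?thesis
        unfolding 6 S using le nsup
        by (auto simp: literal_def le_supI1 le_supI2 split: if_splits)
    qed (use le A B C nB nC in \<open>auto simp: literal_def split: if_splits\<close>)
  qed (rule m)
qed

lemma sum_bool_triple:
  fixes f :: "bool \<times> bool \<times> bool \<Rightarrow> real"
  shows "sum f UNIV =
    f (True, True, True) + f (True, True, False) + f (True, False, True) + f (True, False, False)
    + f (False, True, True) + f (False, True, False) + f (False, False, True) + f (False, False, False)"
proof -
  have U: "UNIV = {(True, True, True), (True, True, False), (True, False, True), (True, False, False),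
    (False, True, True), (False, True, False), (False, False, True), (False, False, False)}"
    by auto
  show ?thesis unfolding U by simp
qed

text \<open>Once the atom $A\overline{B}C$ has mass \<open>q\<close>, the masses of $A$, $A\overline{B}$,
  $A\overline{C}$, $C$, $BC$ given $A\vee C$ determine those of all other atoms, and the six
  inequalities say that these are nonnegative. Such a \<open>q\<close> exists because each lower bound lies
  below each upper bound. Only two of these nine comparisons can fail for numbers in the unit
  interval: \<open>(y - z) * t \<le> (1 - x) * (1 - z * t)\<close>, which is the first joint bound, and
  \<open>(1 - z) * t - x * (1 - z * t) \<le> y * t\<close>, which is the second.\<close>

lemma joint_mass_exists:
  assumes "0 \<le> x" "x \<le> 1" "0 \<le> y" "y \<le> 1" "0 \<le> t" "t \<le> 1" "0 \<le> z" "z \<le> (1::real)"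
    and bounds: "jointly_bounded x y t z" "jointly_bounded (1 - x) (1 - y) t z"
  obtains q where "0 \<le> q" "(y - z) * t \<le> q" "(1 - z) * t - x * (1 - z * t) \<le> q"
    "q \<le> y * t" "q \<le> (1 - z) * t" "q \<le> (1 - x) * (1 - z * t)"
proof -
  let ?L = "{0, (y - z) * t, (1 - z) * t - x * (1 - z * t)}"
  let ?U = "{y * t, (1 - z) * t, (1 - x) * (1 - z * t)}"
  have "z * t \<le> 1"
    using assms by (simp add: mult_le_one)
  then have nonneg: "0 \<le> y * t" "0 \<le> (1 - z) * t" "0 \<le> z * t" "0 \<le> (1 - y) * t"
      "0 \<le> x * (1 - z * t)" "0 \<le> (1 - x) * (1 - z * t)"
    using assms by auto
  have "l \<le> u" if "l \<in> ?L" "u \<in> ?U" for l u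
    using that nonneg bounds \<open>t \<le> 1\<close> unfolding jointly_bounded_def
    by (elim insertE emptyE; simp only: algebra_simps; linarith)
  then have "Max ?L \<le> u" if "u \<in> ?U" for u
    using that by (subst Max_le_iff) auto
  moreover have "l \<le> Max ?L" if "l \<in> ?L" for l
    using that by (intro Max_ge) auto
  ultimately show thesis
    by (intro that[of "Max ?L"]) blast+
qed

text \<open>The masses chosen for a subfamily must charge one of its conditioning events. Masses that
  represent the whole assessment charge $A\vee C$, but they leave out $C$ if $t=z=1$ and $A$ if
  $t=0$. Therefore the bet on $B|C$ alone is tested on $\overline{A}C$, where nothing else constrains
  $B$, and the bets conditional on $A$ alone are tested on $A$, with $B$ and $C$ independent.\<close>

lemma coherent_if_jointly_bounded:
  fixes A B C :: "'a::boolean_algebra"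
  assumes ind: "logically_independent A B C"
    and unit: "0 \<le> x" "x \<le> 1" "0 \<le> y" "y \<le> 1" "0 \<le> t" "t \<le> 1" "0 \<le> z" "z \<le> 1"
    and bounds: "jointly_bounded x y t z" "jointly_bounded (1 - x) (1 - y) t z"
  shows "coherent (family A B C) [x, y, t, z]"
proof (rule coherentI)
  note V = atom_valuation[OF ind]
  let ?V = "atom_valuation A B C"
  show "H \<noteq> bot" if "(E, H) \<in> set (family A B C)" for E H
  proof -
    have "literal A True \<noteq> bot" "literal C True \<noteq> bot"
      using ind unfolding logically_independent_def by (metis inf_bot_left inf_bot_right)+
    then show ?thesis
      using that by (auto simp: literal_def sup_eq_bot_iff)
  qed
  fix J and s :: "nat \<Rightarrow> real"
  assume J0: "J \<noteq> {}" and "J \<subseteq> {..<length (family A B C)}"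
  then have J: "J \<subseteq> {0, 1, 2, 3}"
    unfolding family_index_set by simp
  have by_weights: "\<exists>v. possible (map fst (family A B C) @ map snd (family A B C)) v
      \<and> (\<exists>j\<in>J. v (snd (family A B C ! j))) \<and> gain (family A B C) [x, y, t, z] J s v \<le> 0"
    if nonneg: "\<And>i. 0 \<le> w i" and pos: "\<exists>i. 0 < w i \<and> (\<exists>j\<in>J. ?V i (snd (family A B C ! j)))"
      and bal: "\<And>j. j \<in> J \<Longrightarrow> (\<Sum>i\<in>UNIV. w i * (of_bool (?V i (snd (family A B C ! j))) *
        (of_bool (?V i (fst (family A B C ! j))) - [x, y, t, z] ! j))) = 0"
    for w :: "bool \<times> bool \<times> bool \<Rightarrow> real"
  proof -
    obtain i0 where "0 < w i0" "\<exists>j\<in>J. ?V i0 (snd (family A B C ! j))"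
      using pos by blast
    then obtain i where
      "(\<exists>j\<in>J. ?V i (snd (family A B C ! j))) \<and> gain (family A B C) [x, y, t, z] J s (?V i) \<le> 0"
      using no_sure_win_if_balanced[of UNIV w i0 J ?V "family A B C" "[x, y, t, z]" s] nonneg bal
      by auto
    moreover have "possible (map fst (family A B C) @ map snd (family A B C)) (?V i)"
      using V(7) by (cases i) blast
    ultimately show ?thesis by blast
  qed
  consider "J = {0}" | "J \<subseteq> {1, 3}" | "2 \<in> J \<or> 0 \<in> J \<and> (1 \<in> J \<or> 3 \<in> J)"
    using J J0 by blast
  then show "\<exists>v. possible (map fst (family A B C) @ map snd (family A B C)) v
      \<and> (\<exists>j\<in>J. v (snd (family A B C ! j))) \<and> gain (family A B C) [x, y, t, z] J s v \<le> 0"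
  proof cases
    case 1
    define w :: "bool \<times> bool \<times> bool \<Rightarrow> real" where
      "w = (\<lambda>(a, b, c). if \<not> a \<and> c then (if b then x else 1 - x) else 0)"
    show ?thesis
    proof (rule by_weights[of w])
      show "0 \<le> w i" for i
        using unit by (auto simp: w_def split: prod.splits)
      show "\<exists>i. 0 < w i \<and> (\<exists>j\<in>J. ?V i (snd (family A B C ! j)))"
        using 1 unit
        \<comment> \<open>an atom of positive mass, whether or not \<open>x\<close> vanishes\<close>
        by (intro exI[of _ "(False, 0 < x, True)"]) (auto simp: w_def V)
    qed (auto simp: 1 w_def V sum_bool_triple algebra_simps)
  next
    case 2
    define w :: "bool \<times> bool \<times> bool \<Rightarrow> real" where
      "w = (\<lambda>(a, b, c). of_bool a * (if b then 1 - y else y) * (if c then 1 - z else z))"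
    show ?thesis
    proof (rule by_weights[of w])
      show "0 \<le> w i" for i
        using unit by (auto simp: w_def split: prod.splits)
      obtain j where "j \<in> J" "j = 1 \<or> j = 3"
        using J0 2 by blast
      then have "\<exists>j\<in>J. ?V (True, y < 1, z < 1) (snd (family A B C ! j))"
        by (intro bexI[of _ j]) (auto simp: V)
      moreover have "0 < w (True, y < 1, z < 1)"
        using unit by (auto simp: w_def)
      ultimately show "\<exists>i. 0 < w i \<and> (\<exists>j\<in>J. ?V i (snd (family A B C ! j)))"
        by blast
      fix j assume "j \<in> J"
      then consider "j = 1" | "j = 3" using 2 by blast
      then show "(\<Sum>i\<in>UNIV. w i * (of_bool (?V i (snd (family A B C ! j))) *
          (of_bool (?V i (fst (family A B C ! j))) - [x, y, t, z] ! j))) = 0"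
        by cases (simp_all add: w_def V sum_bool_triple algebra_simps)
    qed
  next
    case 3
    obtain q where q: "0 \<le> q" "(y - z) * t \<le> q" "(1 - z) * t - x * (1 - z * t) \<le> q"
        "q \<le> y * t" "q \<le> (1 - z) * t" "q \<le> (1 - x) * (1 - z * t)"
      using joint_mass_exists[OF unit bounds] .
    define w :: "bool \<times> bool \<times> bool \<Rightarrow> real" where
      "w = (\<lambda>(a, b, c).
        if a then
          if b then if c then (1 - z) * t - q else q - (y - z) * t
          else if c then q else y * t - q
        else if \<not> c then 0
          else if b then q - ((1 - z) * t - x * (1 - z * t))
          else (1 - x) * (1 - z * t) - q)"
    show ?thesis
    proof (rule by_weights[of w])
      show nonneg: "0 \<le> w i" for i
        using q by (auto simp: w_def split: prod.splits)
      have "sum w UNIV = 1"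
        by (simp add: w_def sum_bool_triple algebra_simps)
      then obtain i where "w i \<noteq> 0"
        using sum.neutral[of UNIV w] by force
      then have "0 < w i"
        using nonneg[of i] by simp
      obtain a b c where i: "i = (a, b, c)"
        by (cases i)
      have "a \<or> c"
        using \<open>0 < w i\<close> unfolding i by (auto simp: w_def split: if_splits)
      with 3 consider "2 \<in> J" | "0 \<in> J" "c" | "1 \<in> J" "a" | "3 \<in> J" "a"
        by blast
      then obtain j where "j \<in> J" "?V i (snd (family A B C ! j))"
      proof cases
        case 1 then show thesis using that[of 2] \<open>a \<or> c\<close> by (simp add: i V)
      next
        case 2 then show thesis using that[of 0] by (simp add: i V)
      next
        case 3 then show thesis using that[of 1] by (simp add: i V)
      next
        case 4 then show thesis using that[of 3] by (simp add: i V)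
      qed
      with \<open>0 < w i\<close> show "\<exists>i. 0 < w i \<and> (\<exists>j\<in>J. ?V i (snd (family A B C ! j)))"
        by blast
      fix j assume "j \<in> J"
      then consider "j = 0" | "j = 1" | "j = 2" | "j = 3" using J by blast
      then show "(\<Sum>i\<in>UNIV. w i * (of_bool (?V i (snd (family A B C ! j))) *
          (of_bool (?V i (fst (family A B C ! j))) - [x, y, t, z] ! j))) = 0"
        by cases (simp_all add: w_def V sum_bool_triple algebra_simps)
    qed
  qed
qed simp

section \<open>Extensions of a box of assessments\<close>

text \<open>The left-hand side $x(1-zt)+yt$ increases with $x$ and $y$, but not always with $t$. Where it
  decreases with $t$, lowering $t$ is harmless because the value at $t=0$ is $x\le 1$.\<close>

lemma jointly_bounded_antimono:
  assumes "jointly_bounded x y t z"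
    and "x' \<le> x" "y' \<le> y" "t' \<le> t" "0 \<le> t'" "t \<le> 1" "x \<le> 1" "0 \<le> z" "z \<le> 1"
  shows "jointly_bounded x' y' t' z"
proof -
  have "z * t' \<le> 1"
    using assms by (simp add: mult_le_one)
  then have "x' * (1 - z * t') + y' * t' \<le> x * (1 - z * t') + y * t'"
    using assms by (intro add_mono mult_right_mono) auto
  also have "\<dots> = x + (y - x * z) * t'"
    by (simp add: algebra_simps)
  also have "\<dots> \<le> 1"
  proof (cases "0 \<le> y - x * z")
    case True
    then have "x + (y - x * z) * t' \<le> x + (y - x * z) * t"
      using assms by (intro add_left_mono mult_left_mono)
    then show ?thesis
      using assms(1) by (simp add: jointly_bounded_def algebra_simps)
  next
    case False
    then have "(y - x * z) * t' \<le> 0"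
      using assms by (intro mult_nonpos_nonneg) auto
    then show ?thesis
      using assms by simp
  qed
  finally show ?thesis
    by (simp add: jointly_bounded_def)
qed

lemma jointly_bounded_if_sum_le_1:
  assumes "x + y * t \<le> 1" "0 \<le> x" "0 \<le> t" "0 \<le> z"
  shows "jointly_bounded x y t z"
proof -
  have "0 \<le> x * (z * t)"
    using assms by simp
  then show ?thesis
    using assms(1) by (simp add: jointly_bounded_def algebra_simps)
qed

lemma jointly_bounded_iff_lower_bound:
  assumes "0 < x" "0 < t"
  shows "jointly_bounded x y t z \<longleftrightarrow> (x + y * t - 1) / (t * x) \<le> z"
  using assms by (simp add: jointly_bounded_def divide_le_eq algebra_simps)

text \<open>Along the diagonal from the lower to the upper corner, $x+yt$ changes continuously, so it
  cannot jump over the interval from \<open>l\<close> to \<open>u\<close>.\<close>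

lemma ex_between_in_box:
  fixes x1 :: real
  assumes "x1 \<le> x2" "y1 \<le> y2" "l \<le> u" "l \<le> x2 + y2 * t" "x1 + y1 * t \<le> u"
  obtains x y where "x \<in> {x1..x2}" "y \<in> {y1..y2}" "l \<le> x + y * t" "x + y * t \<le> u"
proof (cases "l \<le> x1 + y1 * t")
  case True
  then show thesis
    using that[of x1 y1] assms by simp
next
  case False
  define f where "f k = (x1 + k * (x2 - x1)) + (y1 + k * (y2 - y1)) * t" for k
  have "f 0 \<le> l" "l \<le> f 1"
    using False assms by (auto simp: f_def)
  moreover have "\<forall>k. 0 \<le> k \<and> k \<le> 1 \<longrightarrow> isCont f k"
    unfolding f_def by (intro allI impI continuous_intros)
  ultimately obtain k where k: "0 \<le> k" "k \<le> 1" "f k = l"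
    using IVT[of f 0 l 1] by auto
  have "0 \<le> k * (x2 - x1)" "k * (x2 - x1) \<le> x2 - x1"
    "0 \<le> k * (y2 - y1)" "k * (y2 - y1) \<le> y2 - y1"
    using k assms by (auto intro: mult_left_le_one_le)
  then show thesis
    using that[of "x1 + k * (x2 - x1)" "y1 + k * (y2 - y1)"] k(3) assms(3)
    by (simp add: f_def)
qed

theorem theorem8:
  fixes A B C :: "'a::boolean_algebra"
    and x1 x2 y1 y2 t1 t2 :: real
    and \<I> :: "real list set" and \<Sigma> :: "real set"
  assumes "logically_independent A B C"
    and "0 \<le> x1" "x1 \<le> x2" "x2 \<le> 1"
    and "0 \<le> y1" "y1 \<le> y2" "y2 \<le> 1"
    and "0 \<le> t1" "t1 \<le> t2" "t2 \<le> 1"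
  defines "\<I> \<equiv> {[x, y, t] | x y t. x \<in> {x1..x2} \<and> y \<in> {y1..y2} \<and> t \<in> {t1..t2}}"
    and "\<Sigma> \<equiv> coherent_extensions [(B, C), (- B, A), (A, sup A C)] \<I> (- C, A)"
  shows "(x2 + y2 * t1 \<ge> t1 \<and> x1 + y1 * t1 \<le> 1 \<longrightarrow> \<Sigma> = {0..1}) \<and>
    (x1 + y1 * t1 > 1 \<longrightarrow> \<Sigma> = {(x1 + y1 * t1 - 1) / (t1 * x1)..1}) \<and>
    (x2 + y2 * t1 < t1 \<longrightarrow> \<Sigma> = {(t1 - x2 - y2 * t1) / (t1 * (1 - x2))..1})"
proof -
  note box = assms(2-10)
  let ?F = "[(B, C), (- B, A), (A, sup A C)]"
  have coherent_iff: "coherent ?F [x, y, t] \<and> coherent (?F @ [(- C, A)]) ([x, y, t] @ [z])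
      \<longleftrightarrow> jointly_bounded x y t z \<and> jointly_bounded (1 - x) (1 - y) t z"
    if "z \<in> {0..1}" "x \<in> {x1..x2}" "y \<in> {y1..y2}" "t \<in> {t1..t2}" for x y t z
  proof -
    have unit: "0 \<le> x" "x \<le> 1" "0 \<le> y" "y \<le> 1" "0 \<le> t" "t \<le> 1" "0 \<le> z" "z \<le> 1"
      using that box by auto
    have "coherent (family A B C) [x, y, t, z]
        \<longleftrightarrow> jointly_bounded x y t z \<and> jointly_bounded (1 - x) (1 - y) t z"
      using coherent_if_jointly_bounded[OF assms(1) unit] jointly_bounded_if_coherent by blast
    moreover have "coherent ?F [x, y, t]" if "coherent (family A B C) [x, y, t, z]"
      using that coherent_butlast[of ?F "(- C, A)" "[x, y, t]" z] by simp
    ultimately show ?thesis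
      by auto
  qed
  have memI: "z \<in> \<Sigma>"
    if "z \<in> {0..1}" "x \<in> {x1..x2}" "y \<in> {y1..y2}"
      "jointly_bounded x y t1 z" "jointly_bounded (1 - x) (1 - y) t1 z" for x y z
    using that coherent_iff[of z x y t1] box
    unfolding \<Sigma>_def coherent_extensions_def \<I>_def by fastforce
  have memE: "z \<in> {0..1}"
      "\<exists>x\<in>{x1..x2}. \<exists>y\<in>{y1..y2}. \<exists>t\<in>{t1..t2}.
        jointly_bounded x y t z \<and> jointly_bounded (1 - x) (1 - y) t z"
    if "z \<in> \<Sigma>" for z
    using that coherent_iff[of z]
    unfolding \<Sigma>_def coherent_extensions_def \<I>_def by blast+
  \<comment> \<open>Each of the two bounds has its own most permissive corner of the box.\<close>
  have necessary: "jointly_bounded x1 y1 t1 z" "jointly_bounded (1 - x2) (1 - y2) t1 z"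
    if z: "z \<in> \<Sigma>" for z
  proof -
    obtain x y t where xyt: "x \<in> {x1..x2}" "y \<in> {y1..y2}" "t \<in> {t1..t2}"
      and b: "jointly_bounded x y t z" "jointly_bounded (1 - x) (1 - y) t z"
      using memE(2)[OF z] by blast
    have "0 \<le> z" "z \<le> 1"
      using memE(1)[OF z] by auto
    then show "jointly_bounded x1 y1 t1 z"
      using xyt box by (intro jointly_bounded_antimono[OF b(1)]) auto
    show "jointly_bounded (1 - x2) (1 - y2) t1 z"
      using \<open>0 \<le> z\<close> \<open>z \<le> 1\<close> xyt box by (intro jointly_bounded_antimono[OF b(2)]) auto
  qed
  show ?thesis
  proof (intro conjI impI)
    assume between: "x2 + y2 * t1 \<ge> t1 \<and> x1 + y1 * t1 \<le> 1"
    have "t1 \<le> 1"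
      using box by simp
    obtain x y where xy: "x \<in> {x1..x2}" "y \<in> {y1..y2}" "t1 \<le> x + y * t1" "x + y * t1 \<le> 1"
      using ex_between_in_box[of x1 x2 y1 y2 t1 1 t1] between \<open>t1 \<le> 1\<close> box by blast
    have "z \<in> \<Sigma>" if z: "z \<in> {0..1}" for z
    proof (rule memI[OF z xy(1,2)])
      show "jointly_bounded x y t1 z"
        using xy box z by (intro jointly_bounded_if_sum_le_1) auto
      show "jointly_bounded (1 - x) (1 - y) t1 z"
        using xy box z by (intro jointly_bounded_if_sum_le_1) (auto simp: left_diff_distrib)
    qed
    then show "\<Sigma> = {0..1}"
      using memE(1) by blast
  next
    assume high: "x1 + y1 * t1 > 1"
    have "y1 * t1 \<le> t1"
      using box by (intro mult_left_le_one_le) auto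
    moreover have "0 < x1"
      using calculation high box by linarith
    moreover have "t1 \<noteq> 0"
      using high box by auto
    ultimately have pos: "0 < x1" "0 < t1"
      using box by auto
    have iff: "z \<in> \<Sigma> \<longleftrightarrow> z \<in> {0..1} \<and> jointly_bounded x1 y1 t1 z" for z
    proof
      assume z: "z \<in> {0..1} \<and> jointly_bounded x1 y1 t1 z"
      then have "jointly_bounded (1 - x1) (1 - y1) t1 z"
        using high box by (intro jointly_bounded_if_sum_le_1) (auto simp: left_diff_distrib)
      then show "z \<in> \<Sigma>"
        using z box by (intro memI[of z x1 y1]) auto
    qed (use memE(1) necessary(1) in blast)
    have "0 \<le> (x1 + y1 * t1 - 1) / (t1 * x1)"
      using high pos by simp
    then show "\<Sigma> = {(x1 + y1 * t1 - 1) / (t1 * x1)..1}"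
      unfolding set_eq_iff iff jointly_bounded_iff_lower_bound[OF pos] by auto
  next
    assume low: "x2 + y2 * t1 < t1"
    have "0 \<le> y2 * t1"
      using box by simp
    then have pos: "0 < 1 - x2" "0 < t1"
      using low box by linarith+
    have iff: "z \<in> \<Sigma> \<longleftrightarrow> z \<in> {0..1} \<and> jointly_bounded (1 - x2) (1 - y2) t1 z" for z
    proof
      assume z: "z \<in> {0..1} \<and> jointly_bounded (1 - x2) (1 - y2) t1 z"
      then have "jointly_bounded x2 y2 t1 z"
        using low box by (intro jointly_bounded_if_sum_le_1) auto
      then show "z \<in> \<Sigma>"
        using z box by (intro memI[of z x2 y2]) auto
    qed (use memE(1) necessary(2) in blast)
    have eq: "1 - x2 + (1 - y2) * t1 - 1 = t1 - x2 - y2 * t1"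
      by (simp add: left_diff_distrib)
    have "0 \<le> (t1 - x2 - y2 * t1) / (t1 * (1 - x2))"
      using low pos by simp
    then show "\<Sigma> = {(t1 - x2 - y2 * t1) / (t1 * (1 - x2))..1}"
      unfolding set_eq_iff iff jointly_bounded_iff_lower_bound[OF pos] eq by auto
  qed
qed

end
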